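(* Let $\mathcal{C}\subseteq\mathbb{Z}_2^\alpha\times R^\beta$ be a $\mathbb{Z}_2R$ linear self-dual code of length $\ell=\alpha+\beta$ and type $(\alpha,\beta;\gamma,\delta;\kappa)$, with generator matrix whose rows are $(\mathbf g_i|\mathbf r_i)$, $\mathbf g_i\in\mathbb{Z}_2^\alpha$, $\mathbf r_i\in R^\beta$, $1\le i\le\gamma+\delta$. Let $\mathbf x\in\mathbb{Z}_2^\alpha$ with $wt_H(\mathbf x)$ odd and $\mathbf y\in R^\beta$ with $wt_L(\mathbf y)$ odd. Let $\mathbf e\in\mathbb{Z}_2^\alpha$ be such that $wt_H(\mathbf e)$ is even and $\langle\mathbf g_i,\mathbf e\rangle=0$ for $1\le i\le\gamma+\delta$, and let $\mathbf a\in u\mathbb{Z}_2^\beta=\{0,u\}^\beta$ satisfy $\langle\mathbf r_i,\mathbf a\rangle=0$ for $1\le i\le\gamma+\delta$. Suppose that $\langle(\mathbf x|\mathbf a),(\mathbf e|\mathbf y)\rangle=0$, and put $h_i=\langle\mathbf g_i,\mathbf x\rangle$, $s_i=\langle\mathbf r_i,\mathbf y\rangle$ for $1\le i\le\gamma+\delta$. Let $t$ be a unit in $R$. Then the matrix $$G=\left(\begin{array}{ccc|ccc}1&0&\mathbf x&0&0&\mathbf a\\0&0&\mathbf e&1&0&\mathbf y\\ \hline h_1&h_1&\mathbf g_1&s_1&ts_1&\mathbf r_1\\ \vdots&\vdots&\vdots&\vdots&\vdots&\vdots\\ h_{\gamma+\delta}&h_{\gamma+\delta}&\mathbf g_{\gamma+\delta}&s_{\gamma+\delta}&ts_{\gamma+\delta}&\mathbf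 r_{\gamma+\delta}\end{array}\right)$$ generates a self-dual code $\mathcal{F}\subseteq\mathbb{Z}_2^{\alpha+2}\times R^{\beta+2}$ over $\mathbb{Z}_2R$ of length $\ell+4$. Furthermore, if $\langle\mathbf x,\mathbf e\rangle=0\in\mathbb{Z}_2$, then $\mathcal{F}$ is separable if and only if $\mathcal{C}$ is separable; otherwise, $\mathcal{F}$ is non-separable.
   Context: Let $R=\mathbb{Z}_2+u\mathbb{Z}_2=\{0,1,u,1+u\}$ with $u^2=0$ (units $1$, $1+u$), and $\eta:R\to\mathbb{Z}_2$, $\eta(r+uq)=r$. The set $\mathbb{Z}_2^\alpha\times R^\beta$ is an $R$-module under $d(a_1,\dots,a_\alpha\mid b_1,\dots,b_\beta)=(\eta(d)a_1,\dots,\eta(d)a_\alpha\mid db_1,\dots,db_\beta)$. A $\mathbb{Z}_2R$ linear code is an $R$-submodule $\mathcal{C}$ of $\mathbb{Z}_2^\alpha\times R^\beta$; a generator matrix is one whose rows generate the code as an $R$-module. Type $(\alpha,\beta;\gamma,\delta;\kappa)$ means $\mathcal{C}\cong(R/uR)^\gamma\oplus R^\delta$ as an $R$-module, and $\kappa=\dim_{\mathbb{Z}_2}$ of the projection to the first $\alpha$ coordinates of the subcode of codewords whose last $\beta$ coordinates lie in $\{0,u\}$. The inner product is $\langle(\mathbf v|\mathbf w),(\mathbf x|\mathbf y)\rangle=u\sum_{i=1}^\alpha v_ix_i+\sum_{j=1}^\beta w_jy_j\in R$; $\mathcal{C}^\perp$ is the set of vectors orthogonal to all of $\mathcal{C}$;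 $\mathcal{C}$ is self-dual if $\mathcal{C}=\mathcal{C}^\perp$. For two vectors in $\mathbb{Z}_2^\alpha$, or two vectors in $R^\beta$, $\langle\cdot,\cdot\rangle$ is the usual dot product with values in $\mathbb{Z}_2$, respectively $R$. $wt_H$ is the Hamming weight; the Lee weight is $wt_L(0)=0$, $wt_L(1)=wt_L(1+u)=1$, $wt_L(u)=2$, extended additively to $R^\beta$. With $\mathcal{C}_X$, $\mathcal{C}_Y$ the projections of a code $\mathcal{C}$ to its $\mathbb{Z}_2$-coordinates and its $R$-coordinates, $\mathcal{C}$ is separable if $\mathcal{C}=\mathcal{C}_X\times\mathcal{C}_Y$, and non-separable otherwise. *)

theory Defs
  imports
    "HOL-Library.Z2"
    "HOL-Algebra.QuotRing"
    "Jordan_Normal_Form.VS_Connect"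
begin

text \<open>The ring \<open>R = Z\<^sub>2 + u Z\<^sub>2\<close> with \<open>u\<^sup>2 = 0\<close>: the value \<open>R2 r q\<close> stands for \<open>r + u q\<close>,
  so the selector \<open>eta\<close> is the reduction map \<open>\<eta>\<close>.\<close>

datatype R2 = R2 (eta: bit) (ucoeff: bit)

lemma R2_exhaust4 [case_names 00 01 10 11]:
  assumes "P (R2 0 0)" "P (R2 0 1)" "P (R2 1 0)" "P (R2 1 1)"
  shows "P a"
proof (cases a)
  case (R2 r q)
  then show ?thesis using assms by (cases r; cases q) simp_all
qed

instantiation R2 :: comm_ring_1
begin

definition zero_R2 :: R2 where "0 = R2 0 0"
definition one_R2 :: R2 where "1 = R2 1 0"
definition plus_R2 :: "R2 \<Rightarrow> R2 \<Rightarrow> R2"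
  where "a + b = R2 (eta a + eta b) (ucoeff a + ucoeff b)"
definition uminus_R2 :: "R2 \<Rightarrow> R2"
  where "- a = R2 (- eta a) (- ucoeff a)"
definition minus_R2 :: "R2 \<Rightarrow> R2 \<Rightarrow> R2"
  where "a - b = R2 (eta a - eta b) (ucoeff a - ucoeff b)"
definition times_R2 :: "R2 \<Rightarrow> R2 \<Rightarrow> R2"
  where "a * b = R2 (eta a * eta b) (eta a * ucoeff b + ucoeff a * eta b)"

instance
proof
  note defs = zero_R2_def one_R2_def plus_R2_def uminus_R2_def minus_R2_def times_R2_def
  fix a b c :: R2
  show "a + b = b + a" and "a * b = b * a"
    by (induct a rule: R2_exhaust4; induct b rule: R2_exhaust4; simp add: defs)+
  show "0 + a = a" and "1 * a = a" and "- a + a = 0"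
    by (induct a rule: R2_exhaust4; simp add: defs)+
  show "a - b = a + - b"
    by (simp add: defs)
  show "a + b + c = a + (b + c)" and "a * b * c = a * (b * c)" and "(a + b) * c = a * c + b * c"
    by (induct a rule: R2_exhaust4; induct b rule: R2_exhaust4; induct c rule: R2_exhaust4;
        simp add: defs)+
  show "(0::R2) \<noteq> 1"
    by (simp add: defs)
qed

end

definition u :: R2 where "u = R2 0 1"

definition of_Z2 :: "bit \<Rightarrow> R2" where "of_Z2 b = R2 b 0"

lemmas R2_defs = zero_R2_def one_R2_def plus_R2_def uminus_R2_def minus_R2_def times_R2_def
  u_def of_Z2_def

lemma R2_decomp: "R2 r q = of_Z2 r + u * of_Z2 q"
  by (simp add: R2_defs)

lemma u_square: "u * u = 0"
  by (simp add: R2_defs)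

lemma R2_cases: "(a::R2) = 0 \<or> a = 1 \<or> a = u \<or> a = 1 + u"
  by (cases a, rename_tac r q, case_tac r; case_tac q) (simp_all add: R2_defs)

lemma R2_distinct: "distinct [0, 1, u, 1 + u]"
  by (simp add: R2_defs)

lemma R2_unit_iff: "(t::R2) dvd 1 \<longleftrightarrow> t = 1 \<or> t = 1 + u"
proof
  assume "t dvd 1"
  then obtain s where "1 = t * s" by (elim dvdE)
  then have "eta t = 1"
    by (cases "eta t") (simp_all add: R2_defs)
  then show "t = 1 \<or> t = 1 + u"
    using R2_cases[of t] by (auto simp: R2_defs)
next
  assume "t = 1 \<or> t = 1 + u"
  then have "1 = t * t"
    by (auto simp: R2_defs)
  then show "t dvd 1" by (rule dvdI)
qed

lemma eta_simps [simp]: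
  "eta 0 = 0" "eta 1 = 1" "eta (a + b) = eta a + eta b" "eta (a * b) = eta a * eta b"
  by (simp_all add: R2_defs)


section \<open>Modules over \<open>R\<close>\<close>

text \<open>\<open>Z\<^sub>2\<^sup>n\<close> with \<open>R\<close> acting through \<open>\<eta>\<close>; the multiplicative fields of a module record are
  irrelevant and left unspecified, as in \<^const>\<open>module_vec\<close>.\<close>

definition Z2_space :: "nat \<Rightarrow> (R2, bit vec) module" where
  "Z2_space n = \<lparr>carrier = carrier_vec n, mult = undefined, one = undefined,
     zero = 0\<^sub>v n, add = (+), smult = (\<lambda>d v. eta d \<cdot>\<^sub>v v)\<rparr>"

definition Z2R_space :: "nat \<Rightarrow> nat \<Rightarrow> (R2, bit vec \<times> R2 vec) module" where
  "Z2R_space \<alpha> \<beta> = direct_sum (Z2_space \<alpha>) (module_vec TYPE(R2) \<beta>)"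

definition R_mod_uR :: "(R2, R2 set) module" where
  "R_mod_uR =
     (let I = PIdl\<^bsub>class_ring\<^esub> u; Q = class_ring Quot I
      in \<lparr>carrier = carrier Q, mult = mult Q, one = one Q, zero = zero Q, add = add Q,
          smult = (\<lambda>d X. (I +>\<^bsub>class_ring\<^esub> d) \<otimes>\<^bsub>Q\<^esub> X)\<rparr>)"

text \<open>The direct sum of \<open>n\<close> copies of \<open>M\<close>.\<close>

definition module_power :: "('r, 'm) module \<Rightarrow> nat \<Rightarrow> ('r, nat \<Rightarrow> 'm) module" where
  "module_power M n = \<lparr>carrier = {..<n} \<rightarrow>\<^sub>E carrier M, mult = undefined, one = undefined,
     zero = (\<lambda>i\<in>{..<n}. \<zero>\<^bsub>M\<^esub>), add = (\<lambda>f g. \<lambda>i\<in>{..<n}. f i \<oplus>\<^bsub>M\<^esub> g i),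
     smult = (\<lambda>d f. \<lambda>i\<in>{..<n}. d \<odot>\<^bsub>M\<^esub> f i)\<rparr>"

definition module_iso ::
  "('r, 'k) ring_scheme \<Rightarrow> ('r, 'm) module \<Rightarrow> ('r, 'n) module \<Rightarrow> bool" where
  "module_iso R M N \<longleftrightarrow>
     (\<exists>\<phi>. \<phi> \<in> LinearCombinations.module_hom R M N \<and> bij_betw \<phi> (carrier M) (carrier N))"

lemma module_Z2_space: "Module.module class_ring (Z2_space n)"
proof (rule moduleI)
  show "abelian_group (Z2_space n)"
  proof (rule abelian_groupI)
    fix x assume "x \<in> carrier (Z2_space n)"
    then show "\<exists>y\<in>carrier (Z2_space n). y \<oplus>\<^bsub>Z2_space n\<^esub> x = \<zero>\<^bsub>Z2_space n\<^esub>"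
      by (intro bexI[of _ "- x"]) (auto simp: Z2_space_def)
  qed (auto simp: Z2_space_def intro: comm_add_vec assoc_add_vec)
qed (auto simp: Z2_space_def class_cring.cring_axioms
    smult_add_distrib_vec add_smult_distrib_vec smult_smult_assoc)

lemma module_Z2R_space: "Module.module class_ring (Z2R_space \<alpha> \<beta>)"
proof -
  interpret V: vec_module "TYPE(R2)" \<beta> .
  show ?thesis
    unfolding Z2R_space_def by (rule direct_sum_is_module[OF module_Z2_space V.module_axioms])
qed

lemma module_R_mod_uR: "Module.module class_ring R_mod_uR"
proof -
  let ?R = "class_ring :: R2 ring"
  let ?I = "PIdl\<^bsub>?R\<^esub> u"
  interpret I: ideal ?I ?R
    by (rule cring.cgenideal_ideal[OF class_cring.cring_axioms]) simp
  interpret Q: cring "?R Quot ?I"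
    by (rule I.quotient_is_cring) (rule class_cring.cring_axioms)
  interpret h: ring_hom_ring ?R "?R Quot ?I" "(+>\<^bsub>?R\<^esub>) ?I"
    by (rule I.rcos_ring_hom_ring)
  have ab: "abelian_group R_mod_uR"
  proof (rule abelian_groupI)
    fix x assume "x \<in> carrier R_mod_uR"
    then show "\<exists>y\<in>carrier R_mod_uR. y \<oplus>\<^bsub>R_mod_uR\<^esub> x = \<zero>\<^bsub>R_mod_uR\<^esub>"
      by (intro bexI[of _ "\<ominus>\<^bsub>?R Quot ?I\<^esub> x"]) (simp_all add: R_mod_uR_def Let_def Q.l_neg)
  qed (simp_all add: R_mod_uR_def Let_def Q.a_ac)
  have c: "?I +>\<^bsub>?R\<^esub> d \<in> carrier (?R Quot ?I)" for d
    by (rule h.hom_closed) simp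
  have hom_add: "?I +>\<^bsub>?R\<^esub> (d + d') = (?I +>\<^bsub>?R\<^esub> d) \<oplus>\<^bsub>?R Quot ?I\<^esub> (?I +>\<^bsub>?R\<^esub> d')" for d d'
    using h.hom_add[of d d'] by simp
  have hom_mult: "?I +>\<^bsub>?R\<^esub> (d * d') = (?I +>\<^bsub>?R\<^esub> d) \<otimes>\<^bsub>?R Quot ?I\<^esub> (?I +>\<^bsub>?R\<^esub> d')" for d d'
    using h.hom_mult[of d d'] by simp
  have hom_one: "?I +>\<^bsub>?R\<^esub> 1 = \<one>\<^bsub>?R Quot ?I\<^esub>"
    using h.hom_one by simp
  show ?thesis
    by (rule moduleI[OF class_cring.cring_axioms ab])
      (simp_all add: R_mod_uR_def Let_def c hom_add hom_mult hom_one
        Q.l_distr Q.r_distr Q.m_assoc)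
qed

lemma module_module_power:
  assumes "Module.module R M"
  shows "Module.module R (module_power M n)"
proof -
  interpret Module.module R M by fact
  let ?P = "module_power M n"
  have eqI: "f = f'" if "f \<in> carrier ?P" "f' \<in> carrier ?P" "\<And>i. i < n \<Longrightarrow> f i = f' i" for f f'
    using that unfolding module_power_def by (auto intro: PiE_ext)
  have ap: "f i \<in> carrier M" if "f \<in> carrier ?P" "i < n" for f i
    using that by (auto simp: module_power_def)
  have add: "f \<oplus>\<^bsub>?P\<^esub> f' \<in> carrier ?P" if "f \<in> carrier ?P" "f' \<in> carrier ?P" for f f'
    using ap[OF that(1)] ap[OF that(2)] by (simp add: module_power_def)
  have zero: "\<zero>\<^bsub>?P\<^esub> \<in> carrier ?P"
    by (simp add: module_power_def)
  have smult: "d \<odot>\<^bsub>?P\<^esub> f \<in> carrier ?P" if "d \<in> carrier R" "f \<in> carrier ?P" for d f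
    using that(1) ap[OF that(2)] by (simp add: module_power_def)
  have at: "(f \<oplus>\<^bsub>?P\<^esub> f') i = f i \<oplus>\<^bsub>M\<^esub> f' i" "\<zero>\<^bsub>?P\<^esub> i = \<zero>\<^bsub>M\<^esub>" "(d \<odot>\<^bsub>?P\<^esub> f) i = d \<odot>\<^bsub>M\<^esub> f i"
    if "i < n" for d f f' i
    using that by (simp_all add: module_power_def)
  have "abelian_group ?P"
  proof (rule abelian_groupI)
    fix f assume f: "f \<in> carrier ?P"
    let ?f = "\<lambda>i\<in>{..<n}. \<ominus>\<^bsub>M\<^esub> f i"
    have c: "?f \<in> carrier ?P"
      using ap[OF f] by (simp add: module_power_def)
    have "?f \<oplus>\<^bsub>?P\<^esub> f = \<zero>\<^bsub>?P\<^esub>"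
      by (rule eqI[OF add[OF c f] zero]) (simp add: at M.l_neg ap[OF f])
    then show "\<exists>y\<in>carrier ?P. y \<oplus>\<^bsub>?P\<^esub> f = \<zero>\<^bsub>?P\<^esub>"
      using c by blast
  qed (rule add zero eqI; simp add: add zero at ap M.a_ac)+
  then show ?thesis
    by (rule moduleI[OF R.cring_axioms])
      (rule smult eqI; simp add: add smult at ap smult_l_distr smult_r_distr smult_assoc1)+
qed


section \<open>Codes\<close>

definition linear_code :: "nat \<Rightarrow> nat \<Rightarrow> (bit vec \<times> R2 vec) set \<Rightarrow> bool" where
  "linear_code \<alpha> \<beta> C \<longleftrightarrow> LinearCombinations.submodule class_ring C (Z2R_space \<alpha> \<beta>)"

definition generated_code ::
  "nat \<Rightarrow> nat \<Rightarrow> (bit vec \<times> R2 vec) list \<Rightarrow> (bit vec \<times> R2 vec) set" where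
  "generated_code \<alpha> \<beta> rs =
     LinearCombinations.module.span class_ring (Z2R_space \<alpha> \<beta>) (set rs)"

text \<open>A matrix is given by the list of its rows.\<close>

definition generator_matrix ::
  "nat \<Rightarrow> nat \<Rightarrow> (bit vec \<times> R2 vec) list \<Rightarrow> (bit vec \<times> R2 vec) set \<Rightarrow> bool" where
  "generator_matrix \<alpha> \<beta> rs C \<longleftrightarrow>
     set rs \<subseteq> carrier_vec \<alpha> \<times> carrier_vec \<beta> \<and> generated_code \<alpha> \<beta> rs = C"

definition inner :: "bit vec \<times> R2 vec \<Rightarrow> bit vec \<times> R2 vec \<Rightarrow> R2" where
  "inner c d = u * of_Z2 (fst c \<bullet> fst d) + snd c \<bullet> snd d"

definition dual_code ::
  "nat \<Rightarrow> nat \<Rightarrow> (bit vec \<times> R2 vec) set \<Rightarrow> (bit vec \<times> R2 vec) set" where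
  "dual_code \<alpha> \<beta> C = {d \<in> carrier_vec \<alpha> \<times> carrier_vec \<beta>. \<forall>c\<in>C. inner d c = 0}"

definition self_dual :: "nat \<Rightarrow> nat \<Rightarrow> (bit vec \<times> R2 vec) set \<Rightarrow> bool" where
  "self_dual \<alpha> \<beta> C \<longleftrightarrow> C = dual_code \<alpha> \<beta> C"

text \<open>The vectors in \<open>u Z\<^sub>2\<^sup>n = {0, u}\<^sup>n\<close>.\<close>

definition uZ2_vecs :: "nat \<Rightarrow> R2 vec set" where
  "uZ2_vecs n = {w \<in> carrier_vec n. \<forall>j<n. w $ j \<in> {0, u}}"

text \<open>In the last conjunct the projected subcode is a \<open>Z\<^sub>2\<close>-subspace of \<open>Z\<^sub>2\<^sup>\<alpha>\<close>.\<close>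

definition code_type ::
  "nat \<Rightarrow> nat \<Rightarrow> nat \<Rightarrow> nat \<Rightarrow> nat \<Rightarrow> (bit vec \<times> R2 vec) set \<Rightarrow> bool" where
  "code_type \<alpha> \<beta> \<gamma> \<delta> \<kappa> C \<longleftrightarrow>
     module_iso class_ring ((Z2R_space \<alpha> \<beta>)\<lparr>carrier := C\<rparr>)
       (direct_sum (module_power R_mod_uR \<gamma>) (module_vec TYPE(R2) \<delta>)) \<and>
     \<kappa> = vectorspace.dim class_ring
           ((module_vec TYPE(bit) \<alpha>)\<lparr>carrier := fst ` {c \<in> C. snd c \<in> uZ2_vecs \<beta>}\<rparr>)"

definition separable :: "(bit vec \<times> R2 vec) set \<Rightarrow> bool" where
  "separable C \<longleftrightarrow> C = (fst ` C) \<times> (snd ` C)"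

definition wt_H :: "bit vec \<Rightarrow> nat" where
  "wt_H v = card {i. i < dim_vec v \<and> v $ i \<noteq> 0}"

definition lee :: "R2 \<Rightarrow> nat" where
  "lee a = (if a = 0 then 0 else if a = u then 2 else 1)"

definition wt_L :: "R2 vec \<Rightarrow> nat" where
  "wt_L w = (\<Sum>j<dim_vec w. lee (w $ j))"

end

(* Each codeword c = (c1 | c2) of C lifts to (c1.x, c1.x, c1 | c2.y, t (c2.y), c2); since the
   characteristic is 2 and t^2 = 1, the lift preserves inner products, so F is self-orthogonal.
   Conversely, a vector orthogonal to F becomes (0, q, v | 0, n, w) after adding multiples of the
   first two rows.  By self-duality (e | 0) and (0 | a) lie in C, and so does
   c = (v + q x + n e | w + t n y + q a); orthogonality to the first two rows forces c1.x = q and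
   c2.y = t n, so that (0, q, v | 0, n, w) is the lift of c plus q and t n times these rows.
   A linear code is separable iff (v | 0) belongs to it for every codeword (v | w).  For x.e = 0 the
   lifts of (0 | a) and (e | 0) split the first two rows; for x.e = 1 the Z_2-part of the first row
   is not orthogonal to the second row. *)

theory Submission
  imports Defs
begin

section \<open>Arithmetic of Z_2 and R in characteristic 2\<close>

declare add_bit_eq_xor [simp del] mult_bit_eq_and [simp del]

text \<open>The second form cancels a repeated summand inside a longer sum, once associativity and
  commutativity have made the two copies adjacent.\<close>

lemma bit_add_self [simp]: "b + b = 0" "b + (b + c) = c" for b c :: bit
  by (cases b; cases c; simp)+

lemma R2_add_self [simp]: "d + d = 0" "d + (d + f) = f" for d f :: R2
  by (cases d; cases f; simp add: R2_defs)+

lemma of_Z2_hom [simp]: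
  "of_Z2 0 = 0" "of_Z2 1 = 1" "of_Z2 (b + c) = of_Z2 b + of_Z2 c"
  "of_Z2 (b * c) = of_Z2 b * of_Z2 c" "eta (of_Z2 b) = b" "eta u = 0"
  by (simp_all add: R2_defs)

lemma u_neq_0 [simp]: "u \<noteq> 0"
  by (simp add: R2_defs)

lemma u_mult_eq_0_iff [simp]: "u * d = 0 \<longleftrightarrow> eta d = 0"
  by (simp add: R2_defs)

lemma R2_unit_square: "t * t = 1" if "t dvd 1" for t :: R2
  using that by (auto simp: R2_unit_iff algebra_simps u_square)

section \<open>Linear codes and the codes generated by rows\<close>

lemma linear_code_iff:
  "linear_code \<alpha> \<beta> C \<longleftrightarrow> C \<subseteq> carrier_vec \<alpha> \<times> carrier_vec \<beta> \<and> (0\<^sub>v \<alpha>, 0\<^sub>v \<beta>) \<in> C \<and>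
     (\<forall>v w v' w'. (v, w) \<in> C \<longrightarrow> (v', w') \<in> C \<longrightarrow> (v + v', w + w') \<in> C) \<and>
     (\<forall>d v w. (v, w) \<in> C \<longrightarrow> (eta d \<cdot>\<^sub>v v, d \<cdot>\<^sub>v w) \<in> C)"
  using module_Z2R_space[of \<alpha> \<beta>]
  by (auto simp: linear_code_def submodule_def Z2R_space_def direct_sum_def Z2_space_def
      module_vec_def)

lemma carrier_Z2R_space: "carrier (Z2R_space \<alpha> \<beta>) = carrier_vec \<alpha> \<times> carrier_vec \<beta>"
  by (simp add: Z2R_space_def direct_sum_def Z2_space_def module_vec_def)

lemma
  assumes "set rs \<subseteq> carrier_vec \<alpha> \<times> carrier_vec \<beta>"
  shows linear_generated_code: "linear_code \<alpha> \<beta> (generated_code \<alpha> \<beta> rs)"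
    and generators_in_generated_code: "set rs \<subseteq> generated_code \<alpha> \<beta> rs"
proof -
  interpret M: Module.module class_ring "Z2R_space \<alpha> \<beta>"
    by (rule module_Z2R_space)
  show "linear_code \<alpha> \<beta> (generated_code \<alpha> \<beta> rs)"
    using M.span_is_submodule[of "set rs"] assms
    by (simp add: linear_code_def generated_code_def carrier_Z2R_space)
  show "set rs \<subseteq> generated_code \<alpha> \<beta> rs"
    using M.in_own_span[of "set rs"] assms
    by (simp add: generated_code_def carrier_Z2R_space)
qed

text \<open>Serves as an induction principle: a property that cuts out a linear code need only be
  checked on generators.\<close>

lemma generated_code_subset:
  assumes "set rs \<subseteq> C" and "linear_code \<alpha> \<beta> C"
  shows "generated_code \<alpha> \<beta> rs \<subseteq> C"
proof -
  interpret M: Module.module class_ring "Z2R_space \<alpha> \<beta>"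
    by (rule module_Z2R_space)
  show ?thesis
    using M.span_is_subset assms by (simp add: linear_code_def generated_code_def)
qed

section \<open>The inner product and dual codes\<close>

lemma inner_commute:
  assumes "c \<in> carrier_vec \<alpha> \<times> carrier_vec \<beta>" and "d \<in> carrier_vec \<alpha> \<times> carrier_vec \<beta>"
  shows "inner c d = inner d c"
  using assms by (auto simp: inner_def comm_scalar_prod[of _ \<alpha>] comm_scalar_prod[of _ \<beta>])

lemma inner_add_left:
  assumes "{(v, w), (v', w'), c} \<subseteq> carrier_vec \<alpha> \<times> carrier_vec \<beta>"
  shows "inner (v + v', w + w') c = inner (v, w) c + inner (v', w') c"
  using assms
  by (auto simp: inner_def add_scalar_prod_distrib[of _ \<alpha>] add_scalar_prod_distrib[of _ \<beta>]
      algebra_simps)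

lemma inner_smult_left:
  assumes "{(v, w), c} \<subseteq> carrier_vec \<alpha> \<times> carrier_vec \<beta>"
  shows "inner (eta d \<cdot>\<^sub>v v, d \<cdot>\<^sub>v w) c = d * inner (v, w) c"
proof -
  \<comment> \<open>The factor \<open>u\<close> kills the \<open>u\<close>-part of \<open>d\<close>,
    so \<open>d\<close> and \<open>eta d\<close> act alike on the binary summand.\<close>
  have "u * (of_Z2 (eta d) * k) = d * (u * k)" for k
    by (simp add: R2_defs)
  then show ?thesis
    using assms
    by (auto simp: inner_def smult_scalar_prod_distrib[of _ \<alpha>] smult_scalar_prod_distrib[of _ \<beta>]
        distrib_left)
qed

text \<open>The old coordinates stay folded inside \<open>inner\<close>, ready for orthogonality
  facts about the original code.\<close>

lemma inner_vCons:
  "inner (vCons p (vCons q v), vCons m (vCons n w))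
     (vCons p' (vCons q' v'), vCons m' (vCons n' w')) =
     u * of_Z2 (p * p' + q * q') + m * m' + n * n' + inner (v, w) (v', w')"
  by (simp add: inner_def algebra_simps)

lemma linear_dual_code:
  assumes "C \<subseteq> carrier_vec \<alpha> \<times> carrier_vec \<beta>"
  shows "linear_code \<alpha> \<beta> (dual_code \<alpha> \<beta> C)"
proof -
  have "inner (0\<^sub>v \<alpha>, 0\<^sub>v \<beta>) c = 0" if "c \<in> C" for c
    using that assms by (auto simp: inner_def)
  moreover have "inner (v + v', w + w') c = 0"
    if "(v, w) \<in> dual_code \<alpha> \<beta> C" "(v', w') \<in> dual_code \<alpha> \<beta> C" "c \<in> C" for v w v' w' c
    using that assms by (subst inner_add_left[of _ _ _ _ _ \<alpha> \<beta>]) (auto simp: dual_code_def)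
  moreover have "inner (eta d \<cdot>\<^sub>v v, d \<cdot>\<^sub>v w) c = 0"
    if "(v, w) \<in> dual_code \<alpha> \<beta> C" "c \<in> C" for d v w c
    using that assms by (subst inner_smult_left[of _ _ _ \<alpha> \<beta>]) (auto simp: dual_code_def)
  ultimately show ?thesis
    by (auto simp: linear_code_iff dual_code_def)
qed

text \<open>The vectors orthogonal to a fixed \<open>d\<close> form a linear code, so orthogonality
  to the generators passes to all that they generate.\<close>

lemma dual_generated_code:
  assumes "set rs \<subseteq> carrier_vec \<alpha> \<times> carrier_vec \<beta>"
  shows "dual_code \<alpha> \<beta> (generated_code \<alpha> \<beta> rs) = dual_code \<alpha> \<beta> (set rs)"
proof
  show "dual_code \<alpha> \<beta> (generated_code \<alpha> \<beta> rs) \<subseteq> dual_code \<alpha> \<beta> (set rs)"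
    using generators_in_generated_code[OF assms] by (auto simp: dual_code_def)
  show "dual_code \<alpha> \<beta> (set rs) \<subseteq> dual_code \<alpha> \<beta> (generated_code \<alpha> \<beta> rs)"
  proof
    fix d assume d: "d \<in> dual_code \<alpha> \<beta> (set rs)"
    then have dc: "d \<in> carrier_vec \<alpha> \<times> carrier_vec \<beta>"
      by (simp add: dual_code_def)
    have "set rs \<subseteq> dual_code \<alpha> \<beta> {d}"
      using d assms dc inner_commute[OF dc] by (fastforce simp: dual_code_def)
    then have "generated_code \<alpha> \<beta> rs \<subseteq> dual_code \<alpha> \<beta> {d}"
      using dc by (intro generated_code_subset linear_dual_code) auto
    then show "d \<in> dual_code \<alpha> \<beta> (generated_code \<alpha> \<beta> rs)"
      using dc inner_commute[OF dc] by (fastforce simp: dual_code_def)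
  qed
qed

section \<open>Separability of linear codes\<close>

text \<open>For the converse, the sum of \<open>(v, 0)\<close>, \<open>(v', 0)\<close> and
  \<open>(v', w')\<close> is \<open>(v, w')\<close>, since \<open>v' + v'\<close> vanishes. The
  condition on single codewords cuts out a subcode, so it can be tested on generators.\<close>

lemma separable_iff:
  assumes "linear_code \<alpha> \<beta> C"
  shows "separable C \<longleftrightarrow> (\<forall>(v, w)\<in>C. (v, 0\<^sub>v \<beta>) \<in> C)"
proof
  assume "separable C"
  moreover have "0\<^sub>v \<beta> \<in> snd ` C"
    using assms by (force simp: linear_code_iff)
  ultimately show "\<forall>(v, w)\<in>C. (v, 0\<^sub>v \<beta>) \<in> C"
    unfolding separable_def by (metis (no_types, lifting) case_prodI2 fst_conv mem_Sigma_iff)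
next
  assume split: "\<forall>(v, w)\<in>C. (v, 0\<^sub>v \<beta>) \<in> C"
  have "(v, w') \<in> C" if vw: "(v, w) \<in> C" and vw': "(v', w') \<in> C" for v w v' w'
  proof -
    have add: "(p + p', q + q') \<in> C" if "(p, q) \<in> C" "(p', q') \<in> C" for p q p' q'
      using assms that by (simp add: linear_code_iff)
    have dims: "v \<in> carrier_vec \<alpha>" "v' \<in> carrier_vec \<alpha>" "w' \<in> carrier_vec \<beta>"
      using assms vw vw' by (auto simp: linear_code_iff)
    have "(v + (v' + v'), 0\<^sub>v \<beta> + (0\<^sub>v \<beta> + w')) \<in> C"
      using split vw vw' by (intro add) auto
    also have "v + (v' + v') = v"
      using dims by (intro eq_vecI) auto
    finally show ?thesis
      using dims by simp
  qed
  then show "separable C"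
    by (force simp: separable_def)
qed

section \<open>Weights modulo 2 as self-products\<close>

lemma of_nat_char_2:
  assumes "1 + 1 = (0 :: 'a :: semiring_1)"
  shows "of_nat n = (of_bool (odd n) :: 'a)"
  using assms by (induction n) auto

lemma scalar_prod_self_Z2: "v \<bullet> v = of_bool (odd (wt_H v))"
proof -
  have "v \<bullet> v = (\<Sum>i<dim_vec v. if v $ i \<noteq> 0 then 1 else 0)"
    by (auto simp: scalar_prod_def lessThan_atLeast0 intro!: sum.cong)
  also have "\<dots> = of_nat (wt_H v)"
    by (simp add: wt_H_def sum.If_cases Int_def)
  finally show ?thesis
    by (simp only: of_nat_char_2 bit_add_self)
qed

text \<open>Both units of R square to 1 and have Lee weight 1, while 0 and \<open>u\<close> square
  to 0 and have Lee weights 0 and 2. Each square is thus the Lee weight modulo 2.\<close>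

lemma scalar_prod_self_R2: "w \<bullet> w = of_bool (odd (wt_L w))"
proof -
  have char: "1 + 1 = (0 :: R2)"
    by simp
  have "d * d = of_nat (lee d)" for d :: R2
    unfolding of_nat_char_2[OF char] using R2_cases[of d]
    by (auto simp: lee_def algebra_simps u_square R2_defs)
  then have "w \<bullet> w = of_nat (wt_L w)"
    by (simp add: scalar_prod_def wt_L_def lessThan_atLeast0)
  then show ?thesis
    by (simp only: of_nat_char_2[OF char])
qed

section \<open>Vectors with a prepended coordinate\<close>

lemma vCons_add:
  assumes "v \<in> carrier_vec n" and "w \<in> carrier_vec n"
  shows "vCons p v + vCons q w = vCons (p + q) (v + w)"
  using assms
  by (intro eq_vecI) (auto simp: vec_index_vCons)

lemma vCons_smult: "d \<cdot>\<^sub>v vCons p v = vCons (d * p) (d \<cdot>\<^sub>v v)"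
  by (intro eq_vecI) (auto simp: vec_index_vCons)

lemma carrier_vec_SucE:
  assumes "v \<in> carrier_vec (Suc n)"
  obtains p w where "v = vCons p w" "w \<in> carrier_vec n"
  using assms by (cases v) auto

section \<open>The extended code and the lift of codewords\<close>

text \<open>The hypotheses enter in condensed form: odd weights as self-products equal to 1, the
  conditions on \<open>e\<close> and \<open>a\<close> as membership of \<open>(e, 0)\<close> and
  \<open>(0, a)\<close> in \<open>C\<close>, and the unit \<open>t\<close> through
  \<open>t * t = 1\<close>.\<close>

locale self_dual_extension =
  fixes \<alpha> \<beta> :: nat and C :: "(bit vec \<times> R2 vec) set" and rs :: "(bit vec \<times> R2 vec) list"
    and x e :: "bit vec" and y a :: "R2 vec" and t :: R2
  assumes gen: "generator_matrix \<alpha> \<beta> rs C" and self_dual: "self_dual \<alpha> \<beta> C"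
    and x [simp]: "x \<in> carrier_vec \<alpha>" and y [simp]: "y \<in> carrier_vec \<beta>"
    and xx: "x \<bullet> x = 1" and yy: "y \<bullet> y = 1"
    and e_mem: "(e, 0\<^sub>v \<beta>) \<in> C" and a_mem: "(0\<^sub>v \<alpha>, a) \<in> C"
    and ortho: "inner (x, a) (e, y) = 0" and tt: "t * t = 1"
begin

definition row_x :: "bit vec \<times> R2 vec" where
  "row_x = (vCons 1 (vCons 0 x), vCons 0 (vCons 0 a))"

definition row_y :: "bit vec \<times> R2 vec" where
  "row_y = (vCons 0 (vCons 0 e), vCons 1 (vCons 0 y))"

text \<open>Defined on arbitrary pairs: the entries \<open>h_i\<close> and \<open>s_i\<close> depend
  linearly on the i-th generator, so the lower rows of the matrix extend to a linear map on
  \<open>C\<close>.\<close>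

definition lift :: "bit vec \<times> R2 vec \<Rightarrow> bit vec \<times> R2 vec" where
  "lift c = (vCons (fst c \<bullet> x) (vCons (fst c \<bullet> x) (fst c)),
             vCons (snd c \<bullet> y) (vCons (t * (snd c \<bullet> y)) (snd c)))"

definition ext_rows :: "(bit vec \<times> R2 vec) list" where
  "ext_rows = [row_x, row_y] @ map lift rs"

definition ext_code :: "(bit vec \<times> R2 vec) set" where
  "ext_code = generated_code (\<alpha> + 2) (\<beta> + 2) ext_rows"

lemma eta_t [simp]: "eta t = 1"
  using arg_cong[OF tt, of eta] by (cases "eta t") auto

lemma linear: "linear_code \<alpha> \<beta> C"
  using gen linear_generated_code by (auto simp: generator_matrix_def)

lemma C_carrier: "(v, w) \<in> C \<Longrightarrow> v \<in> carrier_vec \<alpha>" "(v, w) \<in> C \<Longrightarrow> w \<in> carrier_vec \<beta>"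
  using linear by (auto simp: linear_code_iff)

lemma e [simp]: "e \<in> carrier_vec \<alpha>" and a [simp]: "a \<in> carrier_vec \<beta>"
  using C_carrier e_mem a_mem by blast+

lemmas dims [simp] =
  x[THEN carrier_vecD] y[THEN carrier_vecD] e[THEN carrier_vecD] a[THEN carrier_vecD]

lemma mem_C_iff:
  "(v, w) \<in> C \<longleftrightarrow> v \<in> carrier_vec \<alpha> \<and> w \<in> carrier_vec \<beta> \<and> (\<forall>c\<in>C. inner (v, w) c = 0)"
  using self_dual by (auto simp: self_dual_def dual_code_def)

lemma C_orthogonal: "inner c d = 0" if "c \<in> C" "d \<in> C"
  using that mem_C_iff by (cases c) blast

text \<open>The inner product with \<open>(e, 0)\<close> is \<open>u\<close> times the binary
  product, and with \<open>(0, a)\<close> it is the product over R alone.\<close>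

lemma orth_e: "v \<bullet> e = 0" and orth_a: "w \<bullet> a = 0" if "(v, w) \<in> C"
  using C_orthogonal[OF that e_mem] C_orthogonal[OF that a_mem] C_carrier[OF that]
  by (auto simp: inner_def)

lemma lift_carrier:
  "c \<in> carrier_vec \<alpha> \<times> carrier_vec \<beta> \<Longrightarrow> lift c \<in> carrier_vec (\<alpha> + 2) \<times> carrier_vec (\<beta> + 2)"
  by (auto simp: lift_def)

lemma ext_rows_carrier: "set ext_rows \<subseteq> carrier_vec (\<alpha> + 2) \<times> carrier_vec (\<beta> + 2)"
proof -
  have "lift c \<in> carrier_vec (\<alpha> + 2) \<times> carrier_vec (\<beta> + 2)" if "c \<in> set rs" for c
    using that gen by (intro lift_carrier) (auto simp: generator_matrix_def)
  then show ?thesis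
    by (simp add: ext_rows_def row_x_def row_y_def image_subset_iff)
qed

lemma linear_ext: "linear_code (\<alpha> + 2) (\<beta> + 2) ext_code"
  unfolding ext_code_def using ext_rows_carrier by (rule linear_generated_code)

lemma generator_matrix_ext: "generator_matrix (\<alpha> + 2) (\<beta> + 2) ext_rows ext_code"
  using ext_rows_carrier by (simp add: generator_matrix_def ext_code_def)

lemma ext_add: "(v, w) \<in> ext_code \<Longrightarrow> (v', w') \<in> ext_code \<Longrightarrow> (v + v', w + w') \<in> ext_code"
  using linear_ext by (simp add: linear_code_iff)

lemma ext_smult: "(v, w) \<in> ext_code \<Longrightarrow> (eta d \<cdot>\<^sub>v v, d \<cdot>\<^sub>v w) \<in> ext_code"
  using linear_ext by (simp add: linear_code_iff)

lemma ext_carrier: "ext_code \<subseteq> carrier_vec (\<alpha> + 2) \<times> carrier_vec (\<beta> + 2)"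
  using linear_ext by (simp add: linear_code_iff)

lemma rows_mem_ext: "row_x \<in> ext_code" "row_y \<in> ext_code" "set (map lift rs) \<subseteq> ext_code"
  using generators_in_generated_code[OF ext_rows_carrier]
  by (auto simp: ext_code_def ext_rows_def)

text \<open>Preimages of linear codes under the linear map \<open>lift\<close> are linear; this
  carries membership of the lifted generators in the extended code over to the lifts of all
  codewords.\<close>

lemma linear_lift_vimage:
  assumes "linear_code (\<alpha> + 2) (\<beta> + 2) D"
  shows "linear_code \<alpha> \<beta> {c \<in> carrier_vec \<alpha> \<times> carrier_vec \<beta>. lift c \<in> D}"
proof -
  have "lift (0\<^sub>v \<alpha>, 0\<^sub>v \<beta>) = (0\<^sub>v (\<alpha> + 2), 0\<^sub>v (\<beta> + 2))"
    by (simp add: lift_def zero_vec_Suc)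
  moreover have "lift (v + v', w + w') =
      (fst (lift (v, w)) + fst (lift (v', w')), snd (lift (v, w)) + snd (lift (v', w')))"
    if "v \<in> carrier_vec \<alpha>" "v' \<in> carrier_vec \<alpha>" "w \<in> carrier_vec \<beta>" "w' \<in> carrier_vec \<beta>"
    for v v' w w'
    using that
    by (simp add: lift_def vCons_add[of _ "Suc \<alpha>"] vCons_add[of _ \<alpha>] vCons_add[of _ "Suc \<beta>"]
        vCons_add[of _ \<beta>] add_scalar_prod_distrib[of _ \<alpha>] add_scalar_prod_distrib[of _ \<beta>]
        distrib_left)
  moreover have "lift (eta d \<cdot>\<^sub>v v, d \<cdot>\<^sub>v w) =
      (eta d \<cdot>\<^sub>v fst (lift (v, w)), d \<cdot>\<^sub>v snd (lift (v, w)))"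
    if "v \<in> carrier_vec \<alpha>" "w \<in> carrier_vec \<beta>" for d v w
    using that
    by (simp add: lift_def vCons_smult smult_scalar_prod_distrib[of _ \<alpha>]
        smult_scalar_prod_distrib[of _ \<beta>] mult.left_commute)
  ultimately show ?thesis
    using assms by (auto simp: linear_code_iff)
qed

lemma lift_mem_ext: "lift c \<in> ext_code" if "c \<in> C"
proof -
  have "set rs \<subseteq> {c \<in> carrier_vec \<alpha> \<times> carrier_vec \<beta>. lift c \<in> ext_code}"
    using gen rows_mem_ext(3) by (auto simp: generator_matrix_def)
  from generated_code_subset[OF this linear_lift_vimage[OF linear_ext]]
  have "C \<subseteq> {c \<in> carrier_vec \<alpha> \<times> carrier_vec \<beta>. lift c \<in> ext_code}"
    using gen by (simp add: generator_matrix_def)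
  then show ?thesis
    using that by blast
qed

text \<open>The two equal binary entries contribute the same term twice, and so do the two entries
  over R because \<open>t * t = 1\<close>; in characteristic 2 both pairs cancel.\<close>

lemma inner_lift: "inner (lift c) (lift d) = inner c d"
proof -
  have "t * k * (t * m) = k * m" for k m
    by (metis mult.assoc mult.left_commute mult_1 tt)
  then show ?thesis
    by (simp add: lift_def inner_vCons)
qed

text \<open>The hypothesis on the first two rows, with one summand moved across: it ties
  \<open>x \<bullet> e\<close> to \<open>a \<bullet> y\<close>.\<close>

lemma ortho': "u * of_Z2 (x \<bullet> e) = a \<bullet> y"
proof -
  have "u * of_Z2 (x \<bullet> e) + a \<bullet> y = 0"
    using ortho by (simp add: inner_def)
  then show ?thesis
    by (metis R2_add_self(2) add.right_neutral add.commute)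
qed

section \<open>Self-duality of the extended code\<close>

lemma generators_orthogonal: "inner c d = 0" if "c \<in> set ext_rows" "d \<in> set ext_rows"
proof -
  have rsC: "set rs \<subseteq> C"
    using gen generators_in_generated_code by (auto simp: generator_matrix_def)
  \<comment> \<open>The codewords \<open>(0, a)\<close> and \<open>(e, 0)\<close> are orthogonal to
    themselves.\<close>
  have aa: "a \<bullet> a = 0" and ee: "e \<bullet> e = 0"
    using orth_a[OF a_mem] orth_e[OF e_mem] by auto
  \<comment> \<open>The leading entry 1 of each of the two rows produces a second copy of
    \<open>c1 \<bullet> x\<close> (times \<open>u\<close>) or of \<open>c2 \<bullet> y\<close>,
    which cancels the first.\<close>
  have xl: "inner (lift c) row_x = 0" and yl: "inner (lift c) row_y = 0" if "c \<in> C" for c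
    using orth_a[of "fst c" "snd c"] orth_e[of "fst c" "snd c"] that
    by (simp_all add: lift_def row_x_def row_y_def inner_vCons inner_def)
  have xy: "inner row_x row_y = 0" "inner row_x row_x = 0" "inner row_y row_y = 0"
    using ortho by (simp_all add: row_x_def row_y_def inner_vCons)
      (simp_all add: inner_def aa ee xx yy)
  have sym: "inner c d = inner d c" if "c \<in> set ext_rows" "d \<in> set ext_rows" for c d
    using that ext_rows_carrier inner_commute by blast
  have "inner row_x (lift c) = 0" "inner row_y (lift c) = 0" if "c \<in> set rs" for c
    using that rsC xl[of c] yl[of c] sym[of row_x "lift c"] sym[of row_y "lift c"]
    by (auto simp: ext_rows_def)
  moreover have "inner row_y row_x = 0"
    using sym[of row_x row_y] xy by (simp add: ext_rows_def)
  ultimately show ?thesis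
    using that rsC xl yl xy by (auto simp: ext_rows_def inner_lift subset_iff C_orthogonal)
qed

lemma ext_subset_dual: "ext_code \<subseteq> dual_code (\<alpha> + 2) (\<beta> + 2) ext_code"
proof -
  have "set ext_rows \<subseteq> dual_code (\<alpha> + 2) (\<beta> + 2) ext_code"
    using ext_rows_carrier generators_orthogonal
    unfolding ext_code_def dual_generated_code[OF ext_rows_carrier]
    by (auto simp: dual_code_def)
  from generated_code_subset[OF this linear_dual_code[OF ext_carrier]] show ?thesis
    by (simp only: ext_code_def)
qed

text \<open>Every vector orthogonal to \<open>ext_code\<close> is brought into this shape by adding multiples of
  \<open>row_x\<close> and \<open>row_y\<close>.\<close>

lemma reduced_dual_mem_ext:
  assumes d: "(vCons 0 (vCons q v), vCons 0 (vCons n w)) \<in> dual_code (\<alpha> + 2) (\<beta> + 2) ext_code"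
      (is "?d \<in> _")
  shows "(vCons 0 (vCons q v), vCons 0 (vCons n w)) \<in> ext_code"
proof -
  have [simp]: "v \<in> carrier_vec \<alpha>" "w \<in> carrier_vec \<beta>"
    using d by (auto simp: dual_code_def)
  then have [simp]: "dim_vec v = \<alpha>" "dim_vec w = \<beta>"
    by auto
  \<comment> \<open>Adding \<open>q\<close> times \<open>row_x\<close> and \<open>t * n\<close>
    times \<open>row_y\<close> turns the new coordinates into \<open>q, q\<close> and
    \<open>t * n, n\<close>, the pattern of a lift since \<open>t * (t * n) = n\<close>. The old
    coordinates become \<open>v'\<close> and \<open>w'\<close>; here
    \<open>eta (t * n) = eta n\<close>.\<close>
  define v' where "v' = v + (q \<cdot>\<^sub>v x + eta n \<cdot>\<^sub>v e)"
  define w' where "w' = w + ((t * n) \<cdot>\<^sub>v y + of_Z2 q \<cdot>\<^sub>v a)"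
  have [simp]: "v' \<in> carrier_vec \<alpha>" "w' \<in> carrier_vec \<beta>"
    by (simp_all add: v'_def w'_def)
  have orth: "inner ?d c = 0" if "c \<in> ext_code" for c
    using d that by (simp add: dual_code_def)
  have prod_v': "v' \<bullet> z = v \<bullet> z + q * (x \<bullet> z) + eta n * (e \<bullet> z)" if "z \<in> carrier_vec \<alpha>" for z
    using that
    by (simp add: v'_def add_scalar_prod_distrib[of _ \<alpha>]
        smult_scalar_prod_distrib[of _ \<alpha>] add.assoc)
  have prod_w': "w' \<bullet> z = w \<bullet> z + t * n * (y \<bullet> z) + of_Z2 q * (a \<bullet> z)" if "z \<in> carrier_vec \<beta>" for z
    using that
    by (simp add: w'_def add_scalar_prod_distrib[of _ \<beta>]
        smult_scalar_prod_distrib[of _ \<beta>] add.assoc)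
  have "(v', w') \<in> C"
    unfolding mem_C_iff
  proof (intro conjI ballI)
    fix c assume "c \<in> C"
    then obtain v1 w1 where c: "c = (v1, w1)" and vw1: "(v1, w1) \<in> C"
      by (cases c) auto
    note [simp] = C_carrier[OF vw1]
    have "e \<bullet> v1 = 0" "a \<bullet> w1 = 0"
      using orth_e[OF vw1] orth_a[OF vw1]
      by (simp_all add: comm_scalar_prod[of _ \<alpha>] comm_scalar_prod[of _ \<beta>])
    \<comment> \<open>The multiples of \<open>x\<close> and \<open>y\<close> reproduce the
      contributions of the entries \<open>q\<close> and \<open>n\<close> against the lift.\<close>
    then have "inner (v', w') c = inner ?d (lift c)"
      by (simp add: c lift_def inner_vCons) (simp add: inner_def prod_v' prod_w'
          comm_scalar_prod[of _ \<alpha>, OF x] comm_scalar_prod[of _ \<beta>, OF y] algebra_simps)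
    then show "inner (v', w') c = 0"
      using orth lift_mem_ext[OF \<open>c \<in> C\<close>] by simp
  qed simp_all
  have ex: "e \<bullet> x = x \<bullet> e" and ya: "y \<bullet> a = a \<bullet> y"
    by (simp_all add: comm_scalar_prod[of _ \<alpha>] comm_scalar_prod[of _ \<beta>])
  \<comment> \<open>From \<open>w' \<bullet> a = 0\<close> and orthogonality to \<open>row_x\<close>
    one gets \<open>v \<bullet> x = eta n * (x \<bullet> e)\<close>. This cancels the
    \<open>e\<close>-term of \<open>v' \<bullet> x\<close> and leaves
    \<open>q * (x \<bullet> x)\<close>.\<close>
  have "v' \<bullet> x = q"
  proof -
    have "w \<bullet> a = t * n * (a \<bullet> y)"
    proof -
      have "w \<bullet> a + t * n * (a \<bullet> y) = 0"
        using orth_a[OF \<open>(v', w') \<in> C\<close>] orth_a[OF a_mem] by (simp add: prod_w' ya)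
      then show ?thesis
        by (metis R2_add_self(2) add.right_neutral add.commute)
    qed
    moreover have "u * of_Z2 (v \<bullet> x) + w \<bullet> a = 0"
      using orth[OF rows_mem_ext(1)] by (simp add: row_x_def inner_vCons) (simp add: inner_def)
    ultimately have "u * (of_Z2 (v \<bullet> x) + t * n * of_Z2 (x \<bullet> e)) = 0"
      by (simp only: ortho'[symmetric] algebra_simps)
    then have "v \<bullet> x + eta n * (x \<bullet> e) = 0"
      by simp
    then show ?thesis
      by (simp add: prod_v' xx ex ac_simps)
  qed
  \<comment> \<open>The same argument with \<open>v' \<bullet> e = 0\<close> and
    \<open>row_y\<close>: the \<open>a\<close>-term cancels and
    \<open>t * n * (y \<bullet> y)\<close> remains.\<close>
  moreover have "w' \<bullet> y = t * n"
  proof -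
    have "v \<bullet> e = q * (x \<bullet> e)"
    proof -
      have "v \<bullet> e + q * (x \<bullet> e) = 0"
        using orth_e[OF \<open>(v', w') \<in> C\<close>] orth_e[OF e_mem] by (simp add: prod_v')
      then show ?thesis
        by (metis bit_add_self(2) add.right_neutral add.commute)
    qed
    moreover have "u * of_Z2 (v \<bullet> e) + w \<bullet> y = 0"
      using orth[OF rows_mem_ext(2)] by (simp add: row_y_def inner_vCons) (simp add: inner_def)
    ultimately have "w \<bullet> y + of_Z2 q * (a \<bullet> y) = 0"
      by (simp add: ortho'[symmetric] algebra_simps)
    then show ?thesis
      by (simp add: prod_w' yy ac_simps)
  qed
  ultimately have lift: "lift (v', w') = (vCons q (vCons q v'), vCons (t * n) (vCons n w'))"
    using tt by (simp add: lift_def mult.assoc[symmetric])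
  \<comment> \<open>In characteristic 2, adding the same multiples of the two rows to the lift
    undoes the reduction.\<close>
  have "(vCons q (vCons 0 (q \<cdot>\<^sub>v x)), vCons 0 (vCons 0 (of_Z2 q \<cdot>\<^sub>v a))) \<in> ext_code"
    using ext_smult[OF rows_mem_ext(1)[unfolded row_x_def], of "of_Z2 q"] by (simp add: vCons_smult)
  moreover have "(vCons 0 (vCons 0 (eta n \<cdot>\<^sub>v e)),
      vCons (t * n) (vCons 0 ((t * n) \<cdot>\<^sub>v y))) \<in> ext_code"
    using ext_smult[OF rows_mem_ext(2)[unfolded row_y_def], of "t * n"]
    by (simp add: vCons_smult)
  ultimately have "(vCons q (vCons 0 (q \<cdot>\<^sub>v x)) + vCons 0 (vCons 0 (eta n \<cdot>\<^sub>v e))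
        + vCons q (vCons q v'),
      vCons 0 (vCons 0 (of_Z2 q \<cdot>\<^sub>v a)) + vCons (t * n) (vCons 0 ((t * n) \<cdot>\<^sub>v y))
        + vCons (t * n) (vCons n w')) \<in> ext_code"
    using lift_mem_ext[OF \<open>(v', w') \<in> C\<close>] by (simp add: ext_add lift)
  moreover have "q \<cdot>\<^sub>v x + eta n \<cdot>\<^sub>v e + v' = v"
    by (intro eq_vecI) (auto simp: v'_def ac_simps)
  moreover have "of_Z2 q \<cdot>\<^sub>v a + (t * n) \<cdot>\<^sub>v y + w' = w"
    by (intro eq_vecI) (auto simp: w'_def ac_simps)
  ultimately show ?thesis
    by (simp add: vCons_add[of _ "Suc \<alpha>"] vCons_add[of _ \<alpha>]
        vCons_add[of _ "Suc \<beta>"] vCons_add[of _ \<beta>])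
qed

lemma self_dual_ext: "self_dual (\<alpha> + 2) (\<beta> + 2) ext_code"
proof -
  have "c \<in> ext_code" if c: "c \<in> dual_code (\<alpha> + 2) (\<beta> + 2) ext_code" for c
  proof -
    have dual: "linear_code (\<alpha> + 2) (\<beta> + 2) (dual_code (\<alpha> + 2) (\<beta> + 2) ext_code)"
      using ext_carrier by (rule linear_dual_code)
    then have cc: "c \<in> carrier_vec (Suc (Suc \<alpha>)) \<times> carrier_vec (Suc (Suc \<beta>))"
      using c by (auto simp: linear_code_iff)
    obtain p q v where pqv: "fst c = vCons p (vCons q v)"
      using cc by (elim SigmaE carrier_vec_SucE) auto
    obtain m n w where mnw: "snd c = vCons m (vCons n w)"
      using cc by (elim SigmaE carrier_vec_SucE) auto
    have [simp]: "v \<in> carrier_vec \<alpha>" "w \<in> carrier_vec \<beta>"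
      using cc pqv mnw by auto
    \<comment> \<open>The combination with coefficients \<open>p\<close> and \<open>m\<close> clears
      both leading coordinates of \<open>c\<close>. It lies in the code and hence in its dual, so
      \<open>c + r\<close> stays in the dual, and adding \<open>r\<close> again restores
      \<open>c\<close>.\<close>
    define r where "r = (vCons p (vCons 0 (p \<cdot>\<^sub>v x)) + vCons 0 (vCons 0 (eta m \<cdot>\<^sub>v e)),
      vCons 0 (vCons 0 (of_Z2 p \<cdot>\<^sub>v a)) + vCons m (vCons 0 (m \<cdot>\<^sub>v y)))"
    have r: "r \<in> ext_code"
      unfolding r_def
      using ext_smult[OF rows_mem_ext(1)[unfolded row_x_def], of "of_Z2 p"]
        ext_smult[OF rows_mem_ext(2)[unfolded row_y_def], of m]
      by (intro ext_add) (simp_all add: vCons_smult)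
    have rc: "r \<in> carrier_vec (\<alpha> + 2) \<times> carrier_vec (\<beta> + 2)"
      using r ext_carrier by blast
    have "(fst c + fst r, snd c + snd r) \<in> dual_code (\<alpha> + 2) (\<beta> + 2) ext_code"
      using dual c r ext_subset_dual by (auto simp: linear_code_iff)
    then have "(fst c + fst r, snd c + snd r) \<in> ext_code"
      by (simp add: pqv mnw r_def vCons_add[of _ "Suc \<alpha>"] vCons_add[of _ \<alpha>]
          vCons_add[of _ "Suc \<beta>"] vCons_add[of _ \<beta>] reduced_dual_mem_ext)
    then have "(fst c + fst r + fst r, snd c + snd r + snd r) \<in> ext_code"
      using r by (simp add: ext_add)
    moreover have "fst c + fst r + fst r = fst c" "snd c + snd r + snd r = snd c"
      using cc rc by (auto intro!: eq_vecI simp: ac_simps)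
    ultimately show ?thesis
      by simp
  qed
  then show ?thesis
    using ext_subset_dual by (auto simp: self_dual_def)
qed

section \<open>Separability of the extended code\<close>

lemma ext_orthogonal: "inner c d = 0" if "c \<in> ext_code" "d \<in> ext_code"
  using that self_dual_ext by (auto simp: self_dual_def dual_code_def)

text \<open>Separability would put the binary part of \<open>row_x\<close>, completed by zeros, into
  the code, but its inner product with \<open>row_y\<close> is \<open>u\<close> times
  \<open>x \<bullet> e\<close>.\<close>

lemma not_separable_ext:
  assumes "x \<bullet> e \<noteq> 0"
  shows "\<not> separable ext_code"
proof
  assume "separable ext_code"
  then have "(vCons 1 (vCons 0 x), 0\<^sub>v (\<beta> + 2)) \<in> ext_code"
    using rows_mem_ext(1) by (auto simp: separable_iff[OF linear_ext] row_x_def)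
  from ext_orthogonal[OF this rows_mem_ext(2)] show False
    using assms by (simp add: row_y_def zero_vec_Suc inner_vCons) (simp add: inner_def)
qed

lemma separable_ext_iff:
  assumes "x \<bullet> e = 0"
  shows "separable ext_code \<longleftrightarrow> separable C"
proof
  assume sep: "separable ext_code"
  have "(v, 0\<^sub>v \<beta>) \<in> C" if vw: "(v, w) \<in> C" for v w
    unfolding mem_C_iff
  proof (intro conjI ballI)
    fix c assume "c \<in> C"
    \<comment> \<open>Against any lift, the two equal leading entries cancel and the inner product
      of \<open>(v, 0)\<close> with \<open>c\<close> remains.\<close>
    have "(vCons (v \<bullet> x) (vCons (v \<bullet> x) v), 0\<^sub>v (\<beta> + 2)) \<in> ext_code"
      using sep lift_mem_ext[OF vw] by (auto simp: separable_iff[OF linear_ext] lift_def)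
    from ext_orthogonal[OF this lift_mem_ext[OF \<open>c \<in> C\<close>]] show "inner (v, 0\<^sub>v \<beta>) c = 0"
      by (simp add: lift_def zero_vec_Suc inner_vCons)
  qed (use C_carrier[OF vw] in simp_all)
  then show "separable C"
    by (auto simp: separable_iff[OF linear])
next
  assume sep: "separable C"
  have x_part: "(vCons 1 (vCons 0 x), 0\<^sub>v (\<beta> + 2)) \<in> ext_code"
  proof -
    \<comment> \<open>Hence the lift of \<open>(0, a)\<close> has zeros in all new coordinates and
      removes \<open>a\<close> from \<open>row_x\<close>.\<close>
    have "a \<bullet> y = 0"
      using ortho' assms by simp
    then have "(0\<^sub>v (\<alpha> + 2), vCons 0 (vCons 0 a)) \<in> ext_code"
      using lift_mem_ext[OF a_mem] by (simp add: lift_def zero_vec_Suc)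
    moreover have "a + a = 0\<^sub>v \<beta>"
      using a by (intro eq_vecI) auto
    ultimately show ?thesis
      using ext_add[OF rows_mem_ext(1)[unfolded row_x_def],
          of "0\<^sub>v (\<alpha> + 2)" "vCons 0 (vCons 0 a)"]
      by (simp add: zero_vec_Suc vCons_add[of _ "Suc \<alpha>"] vCons_add[of _ \<alpha>]
          vCons_add[of _ "Suc \<beta>"] vCons_add[of _ \<beta>])
  qed
  have y_part: "(vCons 0 (vCons 0 e), 0\<^sub>v (\<beta> + 2)) \<in> ext_code"
    using lift_mem_ext[OF e_mem] assms
    by (simp add: lift_def zero_vec_Suc comm_scalar_prod[of e \<alpha> x])
  have zero: "(0\<^sub>v (\<alpha> + 2), 0\<^sub>v (\<beta> + 2)) \<in> ext_code"
    using linear_ext by (simp add: linear_code_iff)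
  have "d \<cdot>\<^sub>v 0\<^sub>v (\<beta> + 2) = 0\<^sub>v (\<beta> + 2)" for d :: R2
    by (intro eq_vecI) auto
  \<comment> \<open>The codewords whose binary part splits off form a linear code, so the rows
    suffice.\<close>
  then have "linear_code (\<alpha> + 2) (\<beta> + 2) {(v, w) \<in> ext_code. (v, 0\<^sub>v (\<beta> + 2)) \<in> ext_code}"
    using ext_carrier zero ext_add ext_add[of _ "0\<^sub>v (\<beta> + 2)" _ "0\<^sub>v (\<beta> + 2)"]
      ext_smult ext_smult[of _ "0\<^sub>v (\<beta> + 2)"]
    by (auto simp: linear_code_iff)
  moreover have "(fst (lift c), 0\<^sub>v (\<beta> + 2)) \<in> ext_code" if "c \<in> set rs" for c
  proof -
    have "c \<in> C"
      using that gen generators_in_generated_code by (auto simp: generator_matrix_def)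
    then have "(fst c, 0\<^sub>v \<beta>) \<in> C"
      using sep by (cases c) (auto simp: separable_iff[OF linear])
    from lift_mem_ext[OF this] show ?thesis
      by (simp add: lift_def zero_vec_Suc)
  qed
  then have "set ext_rows \<subseteq> {(v, w) \<in> ext_code. (v, 0\<^sub>v (\<beta> + 2)) \<in> ext_code}"
    using x_part y_part rows_mem_ext
    by (simp add: ext_rows_def row_x_def row_y_def image_subset_iff case_prod_beta)
  ultimately have "ext_code \<subseteq> {(v, w) \<in> ext_code. (v, 0\<^sub>v (\<beta> + 2)) \<in> ext_code}"
    by (subst ext_code_def) (rule generated_code_subset)
  then show "separable ext_code"
    by (auto simp: separable_iff[OF linear_ext])
qed

end

section \<open>From the given matrix to the extension of a self-dual code\<close>

theorem theorem3p7:
  fixes \<alpha> \<beta> \<gamma> \<delta> \<kappa> l :: nat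
    and C F :: "(bit vec \<times> R2 vec) set"
    and g :: "nat \<Rightarrow> bit vec" and r :: "nat \<Rightarrow> R2 vec"
    and x e :: "bit vec" and y a :: "R2 vec"
    and h :: "nat \<Rightarrow> bit" and s :: "nat \<Rightarrow> R2" and t :: R2
    and G :: "(bit vec \<times> R2 vec) list"
  assumes "linear_code \<alpha> \<beta> C" and "self_dual \<alpha> \<beta> C"
    and "l = \<alpha> + \<beta>" and "code_type \<alpha> \<beta> \<gamma> \<delta> \<kappa> C"
    and "generator_matrix \<alpha> \<beta> (map (\<lambda>i. (g i, r i)) [1..<\<gamma> + \<delta> + 1]) C"
    and "x \<in> carrier_vec \<alpha>" and "odd (wt_H x)"
    and "y \<in> carrier_vec \<beta>" and "odd (wt_L y)"
    and "e \<in> carrier_vec \<alpha>" and "even (wt_H e)" and "\<forall>i\<in>{1..\<gamma> + \<delta>}. g i \<bullet> e = 0"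
    and "a \<in> uZ2_vecs \<beta>" and "\<forall>i\<in>{1..\<gamma> + \<delta>}. r i \<bullet> a = 0"
    and "inner (x, a) (e, y) = 0"
    and "\<forall>i\<in>{1..\<gamma> + \<delta>}. h i = g i \<bullet> x" and "\<forall>i\<in>{1..\<gamma> + \<delta>}. s i = r i \<bullet> y"
    and "t dvd 1"
    and "G = [(vCons 1 (vCons 0 x), vCons 0 (vCons 0 a)),
              (vCons 0 (vCons 0 e), vCons 1 (vCons 0 y))]
             @ map (\<lambda>i. (vCons (h i) (vCons (h i) (g i)), vCons (s i) (vCons (t * s i) (r i))))
                 [1..<\<gamma> + \<delta> + 1]"
    and "F = generated_code (\<alpha> + 2) (\<beta> + 2) G"
  shows "generator_matrix (\<alpha> + 2) (\<beta> + 2) G F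
    \<and> linear_code (\<alpha> + 2) (\<beta> + 2) F \<and> self_dual (\<alpha> + 2) (\<beta> + 2) F
    \<and> (\<alpha> + 2) + (\<beta> + 2) = l + 4
    \<and> (x \<bullet> e = 0 \<longrightarrow> (separable F \<longleftrightarrow> separable C))
    \<and> (x \<bullet> e \<noteq> 0 \<longrightarrow> \<not> separable F)"
proof -
  let ?rs = "map (\<lambda>i. (g i, r i)) [1..<\<gamma> + \<delta> + 1]"
  have carrier: "set ?rs \<subseteq> carrier_vec \<alpha> \<times> carrier_vec \<beta>" and C: "C = generated_code \<alpha> \<beta> ?rs"
    using assms(5) by (auto simp: generator_matrix_def)
  have a: "a \<in> carrier_vec \<beta>"
    using assms(13) by (simp add: uZ2_vecs_def)
  have gr: "g i \<in> carrier_vec \<alpha>" "r i \<in> carrier_vec \<beta>" if "i \<in> {1..\<gamma> + \<delta>}" for i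
  proof -
    have "(g i, r i) \<in> set ?rs"
      using that by force
    then show "g i \<in> carrier_vec \<alpha>" "r i \<in> carrier_vec \<beta>"
      using carrier by blast+
  qed
  \<comment> \<open>Membership in \<open>C\<close> is tested by orthogonality to the rows alone,
    which is what the conditions on \<open>e\<close> and \<open>a\<close> provide.\<close>
  have dual: "C = dual_code \<alpha> \<beta> (set ?rs)"
    using assms(2) dual_generated_code[OF carrier] by (simp add: self_dual_def C)
  interpret self_dual_extension \<alpha> \<beta> C ?rs x e y a t
  proof
    show "(e, 0\<^sub>v \<beta>) \<in> C"
      unfolding dual dual_code_def using assms(10,12) gr
      by (auto simp: inner_def comm_scalar_prod[of e \<alpha>])
    show "(0\<^sub>v \<alpha>, a) \<in> C"
      unfolding dual dual_code_def using assms(14) a gr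
      by (auto simp: inner_def comm_scalar_prod[of a \<beta>])
  qed (use assms in \<open>simp_all add: scalar_prod_self_Z2 scalar_prod_self_R2 R2_unit_square\<close>)
  \<comment> \<open>By the choice of \<open>h\<close> and \<open>s\<close> the lower rows are lifts
    of generators; without \<open>upt_Suc\<close> the index list is not split at its end.\<close>
  have G: "G = ext_rows"
    using assms(16,17)
    unfolding assms(19) ext_rows_def row_x_def row_y_def lift_def by (simp del: upt_Suc)
  have F: "F = ext_code"
    unfolding assms(20) ext_code_def G ..
  show ?thesis
    unfolding assms(3) F unfolding G
    using generator_matrix_ext linear_ext self_dual_ext separable_ext_iff not_separable_ext
    by (simp del: upt_Suc)
qed

end
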